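(* Let $R$ be an associative ring with identity. The following are equivalent: (1) Every cyclic left $R$-module is J-torsionless. (2) For every left ideal $I$ of $R$, $I=(J(R):r_R(I))_l$.
   Context: Homomorphisms of left modules are written on the right: $mq$ is the image of $m$ under $q$. $M^*=\mathrm{Hom}_R(M,R)$ for a left $R$-module $M$. $J(R)$ is the Jacobson radical of $R$. A left $R$-module $M$ is J-torsionless if for every $0\neq m\in M$ there is $q\in M^*$ with $mq\notin J(R)$. For a left ideal $I$, $r_R(I)=\{a\in R : Ia=0\}$ is its right annihilator. For subsets $A,B\subseteq R$, $(A:B)_l=\{t\in R : tB\subseteq A\}$. *)

theory Defs
  imports "HOL-Algebra.Ideal" "HOL-Algebra.Module"
begin

text \<open>
  The locale \<open>module\<close> of HOL-Algebra needs a commutative base ring. The following is the same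
  locale over an arbitrary ring with identity, on the same record type; the fields \<open>mult\<close>
  and \<open>one\<close> of the module record are irrelevant.
\<close>

locale left_module = R?: ring R + M?: abelian_group M
  for R (structure) and M (structure) +
  assumes smult_closed:
      "\<lbrakk>a \<in> carrier R; x \<in> carrier M\<rbrakk> \<Longrightarrow> a \<odot>\<^bsub>M\<^esub> x \<in> carrier M"
    and smult_l_distr:
      "\<lbrakk>a \<in> carrier R; b \<in> carrier R; x \<in> carrier M\<rbrakk> \<Longrightarrow>
        (a \<oplus>\<^bsub>R\<^esub> b) \<odot>\<^bsub>M\<^esub> x = a \<odot>\<^bsub>M\<^esub> x \<oplus>\<^bsub>M\<^esub> b \<odot>\<^bsub>M\<^esub> x"
    and smult_r_distr:
      "\<lbrakk>a \<in> carrier R; x \<in> carrier M; y \<in> carrier M\<rbrakk> \<Longrightarrow>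
        a \<odot>\<^bsub>M\<^esub> (x \<oplus>\<^bsub>M\<^esub> y) = a \<odot>\<^bsub>M\<^esub> x \<oplus>\<^bsub>M\<^esub> a \<odot>\<^bsub>M\<^esub> y"
    and smult_assoc1:
      "\<lbrakk>a \<in> carrier R; b \<in> carrier R; x \<in> carrier M\<rbrakk> \<Longrightarrow>
        (a \<otimes>\<^bsub>R\<^esub> b) \<odot>\<^bsub>M\<^esub> x = a \<odot>\<^bsub>M\<^esub> (b \<odot>\<^bsub>M\<^esub> x)"
    and smult_one: "x \<in> carrier M \<Longrightarrow> \<one>\<^bsub>R\<^esub> \<odot>\<^bsub>M\<^esub> x = x"

definition cyclic_left_module :: "('a, 'c) ring_scheme \<Rightarrow> ('a, 'm, 'e) module_scheme \<Rightarrow> bool"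
  where "cyclic_left_module R M \<longleftrightarrow> left_module R M \<and>
    (\<exists>x\<in>carrier M. carrier M = {r \<odot>\<^bsub>M\<^esub> x | r. r \<in> carrier R})"

definition left_regular :: "('a, 'c) ring_scheme \<Rightarrow> ('a, 'a) module"
  where "left_regular R = \<lparr>carrier = carrier R, mult = mult R, one = \<one>\<^bsub>R\<^esub>,
    zero = \<zero>\<^bsub>R\<^esub>, add = add R, smult = mult R\<rparr>"

text \<open>
  As for \<open>hom\<close> in HOL-Algebra, the values of a homomorphism outside the carrier of its domain
  are not constrained. The image \<open>mq\<close> of \<open>m\<close> under \<open>q\<close> is written \<open>q m\<close>.
\<close>

definition left_module_hom ::
    "('a, 'c) ring_scheme \<Rightarrow> ('a, 'm, 'e) module_scheme \<Rightarrow> ('a, 'n, 'f) module_scheme \<Rightarrow> ('m \<Rightarrow> 'n) set"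
  where "left_module_hom R M N = {q \<in> carrier M \<rightarrow> carrier N.
    (\<forall>x\<in>carrier M. \<forall>y\<in>carrier M. q (x \<oplus>\<^bsub>M\<^esub> y) = q x \<oplus>\<^bsub>N\<^esub> q y) \<and>
    (\<forall>r\<in>carrier R. \<forall>x\<in>carrier M. q (r \<odot>\<^bsub>M\<^esub> x) = r \<odot>\<^bsub>N\<^esub> q x)}"

definition left_module_dual ::
    "('a, 'c) ring_scheme \<Rightarrow> ('a, 'm, 'e) module_scheme \<Rightarrow> ('m \<Rightarrow> 'a) set"
  where "left_module_dual R M = left_module_hom R M (left_regular R)"

definition left_ideal :: "'a set \<Rightarrow> ('a, 'c) ring_scheme \<Rightarrow> bool"
  where "left_ideal I R \<longleftrightarrow> additive_subgroup I R \<and>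
    (\<forall>r\<in>carrier R. \<forall>x\<in>I. r \<otimes>\<^bsub>R\<^esub> x \<in> I)"

definition maximal_left_ideal :: "'a set \<Rightarrow> ('a, 'c) ring_scheme \<Rightarrow> bool"
  where "maximal_left_ideal K R \<longleftrightarrow> left_ideal K R \<and> K \<noteq> carrier R \<and>
    (\<forall>L. left_ideal L R \<and> K \<subseteq> L \<longrightarrow> L = K \<or> L = carrier R)"

text \<open>
  The intersection of all maximal left ideals. Intersecting with the carrier makes this the
  whole ring for the zero ring, which has no maximal left ideal.
\<close>

definition jacobson_radical :: "('a, 'c) ring_scheme \<Rightarrow> 'a set"
  where "jacobson_radical R = carrier R \<inter> \<Inter>{K. maximal_left_ideal K R}"

definition J_torsionless :: "('a, 'c) ring_scheme \<Rightarrow> ('a, 'm, 'e) module_scheme \<Rightarrow> bool"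
  where "J_torsionless R M \<longleftrightarrow> (\<forall>m\<in>carrier M. m \<noteq> \<zero>\<^bsub>M\<^esub> \<longrightarrow>
    (\<exists>q\<in>left_module_dual R M. q m \<notin> jacobson_radical R))"

definition right_annihilator :: "('a, 'c) ring_scheme \<Rightarrow> 'a set \<Rightarrow> 'a set"
  where "right_annihilator R I = {a \<in> carrier R. \<forall>x\<in>I. x \<otimes>\<^bsub>R\<^esub> a = \<zero>\<^bsub>R\<^esub>}"

definition left_colon :: "('a, 'c) ring_scheme \<Rightarrow> 'a set \<Rightarrow> 'a set \<Rightarrow> 'a set"
  where "left_colon R A B = {t \<in> carrier R. \<forall>b\<in>B. t \<otimes>\<^bsub>R\<^esub> b \<in> A}"

text \<open>
  A formula cannot quantify over types. Every cyclic left \<open>R\<close>-module is isomorphic to some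
  \<open>R/I\<close>, whose elements are cosets, hence to a module whose elements have type \<open>'a set\<close>
  when those of \<open>R\<close> have type \<open>'a\<close>. So for ``every cyclic left \<open>R\<close>-module'' it is
  enough to use \<open>'m = 'a set\<close>. On a smaller type \<open>'m\<close> the predicate can be strictly weaker.
\<close>

definition all_cyclic_J_torsionless :: "('a, 'c) ring_scheme \<Rightarrow> 'm itself \<Rightarrow> bool"
  where "all_cyclic_J_torsionless R (_ :: 'm itself) \<longleftrightarrow>
    (\<forall>M :: ('a, 'm) module. cyclic_left_module R M \<longrightarrow> J_torsionless R M)"

end

theory Submission
  imports Defs
begin

text \<open>
  Homomorphisms \<open>R/I \<rightarrow> R\<close> are the right multiplications by elements of \<open>r\<^sub>R(I)\<close>: a homomorphism
  \<open>q\<close> corresponds to the image \<open>a\<close> of the coset of \<open>\<one>\<close>, and the coset of \<open>t\<close> then has image \<open>ta\<close>.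
  So \<open>t + I\<close> is sent into \<open>J(R)\<close> by all of them iff \<open>t \<in> (J(R) : r\<^sub>R(I))\<^sub>l\<close>, and the module \<open>R/I\<close> is
  J-torsionless iff this happens for no \<open>t\<close> outside \<open>I\<close>.
\<close>

lemma zero_in_jacobson_radical:
  assumes "ring R"
  shows "\<zero>\<^bsub>R\<^esub> \<in> jacobson_radical R"
proof -
  interpret ring R by fact
  show ?thesis
    by (auto simp: jacobson_radical_def maximal_left_ideal_def left_ideal_def
        intro: additive_subgroup.zero_closed)
qed

text \<open>This inclusion holds over every ring: a product of an element of \<open>I\<close> with
  one of its right annihilator is \<open>\<zero>\<close>, which lies in the radical.\<close>

lemma left_ideal_subset_left_colon:
  assumes "ring R" "left_ideal I R"
  shows "I \<subseteq> left_colon R (jacobson_radical R) (right_annihilator R I)"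
proof
  fix x assume "x \<in> I"
  moreover from this have "x \<in> carrier R"
    using assms(2) additive_subgroup.a_Hcarr unfolding left_ideal_def by fast
  ultimately show "x \<in> left_colon R (jacobson_radical R) (right_annihilator R I)"
    using zero_in_jacobson_radical[OF assms(1)]
    by (simp add: left_colon_def right_annihilator_def)
qed

text \<open>The scalar multiple of a coset is a union over all its representatives, so none has to
  be chosen. For a left ideal \<open>I\<close> the cosets in that union coincide.\<close>

definition quotient_left_module :: "('a, 'c) ring_scheme \<Rightarrow> 'a set \<Rightarrow> ('a, 'a set) module"
  where "quotient_left_module R I = \<lparr>carrier = a_rcosets\<^bsub>R\<^esub> I, mult = undefined, one = undefined,
    zero = I, add = set_add R, smult = (\<lambda>r X. \<Union>x\<in>X. I +>\<^bsub>R\<^esub> (r \<otimes>\<^bsub>R\<^esub> x))\<rparr>"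

section \<open>The cyclic module \<open>R/I\<close> of a left ideal\<close>

context
  fixes R (structure) and I
  assumes ring: "ring R" and left_ideal: "left_ideal I R"
begin

interpretation ring R
  by (rule ring)

interpretation abelian_subgroup I R
  using left_ideal by (intro abelian_subgroupI3 is_abelian_group) (simp add: left_ideal_def)

lemma carrier_quotient_left_module:
  "carrier (quotient_left_module R I) = {I +> x | x. x \<in> carrier R}"
  by (auto simp: quotient_left_module_def A_RCOSETS_defs a_r_coset_defs)

lemma zero_quotient_left_module: "\<zero>\<^bsub>quotient_left_module R I\<^esub> = I"
  by (simp add: quotient_left_module_def)

lemma a_r_coset_eq_self_iff:
  assumes "x \<in> carrier R"
  shows "I +> x = I \<longleftrightarrow> x \<in> I"
  using assms a_rcos_self a_rcos_const by blast

lemma a_r_coset_zero: "I +> \<zero> = I"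
  by (simp add: a_r_coset_eq_self_iff)

lemma add_quotient_left_module:
  "\<lbrakk>x \<in> carrier R; y \<in> carrier R\<rbrakk> \<Longrightarrow>
    (I +> x) \<oplus>\<^bsub>quotient_left_module R I\<^esub> (I +> y) = I +> (x \<oplus> y)"
  by (simp add: quotient_left_module_def a_rcos_sum)

text \<open>Representatives of one coset differ by some \<open>i\<close> in \<open>I\<close>, and
  their multiples by \<open>r \<otimes> i\<close>, which stays in \<open>I\<close> because
  \<open>I\<close> is a left ideal.\<close>

lemma smult_quotient_left_module:
  assumes "r \<in> carrier R" "x \<in> carrier R"
  shows "r \<odot>\<^bsub>quotient_left_module R I\<^esub> (I +> x) = I +> (r \<otimes> x)"
proof -
  have "I +> (r \<otimes> y) = I +> (r \<otimes> x)" if y: "y \<in> I +> x" for y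
  proof -
    obtain i where i: "i \<in> I" "y = i \<oplus> x"
      using y by (auto simp: a_r_coset_def')
    have "r \<otimes> i \<in> I"
      using left_ideal assms i by (auto simp: left_ideal_def)
    moreover have "r \<otimes> y = r \<otimes> i \<oplus> r \<otimes> x"
      using assms i by (simp add: r_distr a_Hcarr)
    ultimately have "r \<otimes> y \<in> I +> (r \<otimes> x)"
      by (auto simp: a_r_coset_def')
    then show ?thesis
      using assms a_repr_independence' by simp
  qed
  \<comment> \<open>A union of equal sets is that set only over a nonempty index set.\<close>
  moreover have "I +> x \<noteq> {}"
    using assms a_rcos_self by blast
  ultimately have "(\<Union>y\<in>I +> x. I +> (r \<otimes> y)) = I +> (r \<otimes> x)"
    by (intro SUP_eq_const)
  then show ?thesis
    by (simp add: quotient_left_module_def)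
qed

lemma left_module_quotient_left_module: "left_module R (quotient_left_module R I)"
proof -
  let ?M = "quotient_left_module R I"
  note simps = carrier_quotient_left_module zero_quotient_left_module
    add_quotient_left_module smult_quotient_left_module
  \<comment> \<open>In the form of a coset, the zero can be added by the rule for sums of
    cosets.\<close>
  have zero: "\<zero>\<^bsub>?M\<^esub> = I +> \<zero>"
    by (simp add: zero_quotient_left_module a_r_coset_zero)
  have "abelian_group ?M"
  proof (rule abelian_groupI)
    fix X assume "X \<in> carrier ?M"
    then obtain x where x: "x \<in> carrier R" "X = I +> x"
      by (auto simp: simps)
    then have "(I +> \<ominus> x) \<oplus>\<^bsub>?M\<^esub> X = \<zero>\<^bsub>?M\<^esub>"
      unfolding zero by (simp add: add_quotient_left_module l_neg)
    with x show "\<exists>Y\<in>carrier ?M. Y \<oplus>\<^bsub>?M\<^esub> X = \<zero>\<^bsub>?M\<^esub>"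
      by (auto simp: carrier_quotient_left_module)
    show "\<zero>\<^bsub>?M\<^esub> \<oplus>\<^bsub>?M\<^esub> X = X"
      unfolding zero using x by (simp add: add_quotient_left_module)
  next
    show "\<zero>\<^bsub>?M\<^esub> \<in> carrier ?M"
      unfolding zero by (auto simp: carrier_quotient_left_module)
  qed (auto simp: carrier_quotient_left_module add_quotient_left_module a_assoc,
      auto simp: a_comm)
  then show ?thesis
    by (auto intro!: left_module.intro left_module_axioms.intro ring
        simp: carrier_quotient_left_module add_quotient_left_module smult_quotient_left_module
          l_distr r_distr m_assoc, blast)
qed

text \<open>The coset of \<open>\<one>\<close> is a generator.\<close>

lemma cyclic_quotient_left_module: "cyclic_left_module R (quotient_left_module R I)"
proof -
  have "carrier (quotient_left_module R I) =
      {r \<odot>\<^bsub>quotient_left_module R I\<^esub> (I +> \<one>) | r. r \<in> carrier R}"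
    by (force simp: carrier_quotient_left_module smult_quotient_left_module)
  moreover have "I +> \<one> \<in> carrier (quotient_left_module R I)"
    by (auto simp: carrier_quotient_left_module)
  ultimately show ?thesis
    using left_module_quotient_left_module unfolding cyclic_left_module_def by blast
qed

text \<open>If \<open>t\<close> is outside \<open>I\<close>, its coset is nonzero, so some
  \<open>q\<close> sends it outside the radical. But \<open>q\<close> is right multiplication by an
  element \<open>a\<close> annihilated by \<open>I\<close>, so membership of \<open>t\<close> in the
  colon puts \<open>t \<otimes> a\<close> in the radical.\<close>

lemma left_colon_subset_left_ideal:
  assumes "J_torsionless R (quotient_left_module R I)"
  shows "left_colon R (jacobson_radical R) (right_annihilator R I) \<subseteq> I"
proof (rule subsetI, rule ccontr)
  let ?M = "quotient_left_module R I"
  fix t assume t: "t \<in> left_colon R (jacobson_radical R) (right_annihilator R I)" "t \<notin> I"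
  then have tR: "t \<in> carrier R"
    by (simp add: left_colon_def)
  then obtain q where q: "q \<in> left_module_dual R ?M" "q (I +> t) \<notin> jacobson_radical R"
    using assms t a_r_coset_eq_self_iff[OF tR]
    unfolding J_torsionless_def carrier_quotient_left_module zero_quotient_left_module by blast
  define a where "a = q (I +> \<one>)"
  have aR: "a \<in> carrier R"
    using q by (auto simp: a_def left_module_dual_def left_module_hom_def left_regular_def
        carrier_quotient_left_module)
  have q_eq: "q (I +> r) = r \<otimes> a" if "r \<in> carrier R" for r
  proof -
    have "I +> \<one> \<in> carrier ?M"
      by (auto simp: carrier_quotient_left_module)
    then have "q (r \<odot>\<^bsub>?M\<^esub> (I +> \<one>)) = r \<otimes> a"
      using q that by (simp add: a_def left_module_dual_def left_module_hom_def left_regular_def)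
    then show ?thesis
      using that by (simp add: smult_quotient_left_module)
  qed
  have "x \<otimes> a = \<zero>" if "x \<in> I" for x
  proof -
    have "x \<otimes> a = q (I +> x)"
      using q_eq that by (simp add: a_Hcarr)
    \<comment> \<open>Since \<open>q\<close> is defined on cosets, it cannot distinguish
      \<open>x\<close> in \<open>I\<close> from \<open>\<zero>\<close>.\<close>
    also have "I +> x = I +> \<zero>"
      using that by (simp add: a_rcos_const a_r_coset_zero)
    also have "q (I +> \<zero>) = \<zero>"
      using q_eq aR by simp
    finally show ?thesis .
  qed
  then have "a \<in> right_annihilator R I"
    using aR by (simp add: right_annihilator_def)
  then have "t \<otimes> a \<in> jacobson_radical R"
    using t by (simp add: left_colon_def)
  then show False
    using q q_eq tR by simp
qed

end

section \<open>Annihilators and functionals on cyclic modules\<close>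

context left_module
begin

text \<open>Two scalars with the same effect on \<open>x\<close> differ by an element of the
  annihilator of \<open>x\<close>; this will make functionals well defined.\<close>

lemma smult_minus_eq_zero:
  assumes "r \<in> carrier R" "s \<in> carrier R" "x \<in> carrier M" "r \<odot>\<^bsub>M\<^esub> x = s \<odot>\<^bsub>M\<^esub> x"
  shows "(r \<ominus>\<^bsub>R\<^esub> s) \<odot>\<^bsub>M\<^esub> x = \<zero>\<^bsub>M\<^esub>"
proof -
  have "(r \<ominus>\<^bsub>R\<^esub> s) \<odot>\<^bsub>M\<^esub> x \<oplus>\<^bsub>M\<^esub> s \<odot>\<^bsub>M\<^esub> x = ((r \<ominus>\<^bsub>R\<^esub> s) \<oplus>\<^bsub>R\<^esub> s) \<odot>\<^bsub>M\<^esub> x"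
    using assms by (simp add: smult_l_distr)
  also have "(r \<ominus>\<^bsub>R\<^esub> s) \<oplus>\<^bsub>R\<^esub> s = r"
    using assms by (simp add: R.minus_eq R.a_assoc R.l_neg)
  finally have "(r \<ominus>\<^bsub>R\<^esub> s) \<odot>\<^bsub>M\<^esub> x \<oplus>\<^bsub>M\<^esub> s \<odot>\<^bsub>M\<^esub> x = \<zero>\<^bsub>M\<^esub> \<oplus>\<^bsub>M\<^esub> s \<odot>\<^bsub>M\<^esub> x"
    using assms by (simp add: smult_closed)
  then show ?thesis
    using assms by (simp add: smult_closed)
qed

lemma smult_zero:
  assumes "x \<in> carrier M"
  shows "\<zero>\<^bsub>R\<^esub> \<odot>\<^bsub>M\<^esub> x = \<zero>\<^bsub>M\<^esub>"
  using smult_minus_eq_zero[of "\<zero>\<^bsub>R\<^esub>" "\<zero>\<^bsub>R\<^esub>" x] assms by (simp add: R.minus_eq)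

lemma smult_zero_right:
  assumes "r \<in> carrier R"
  shows "r \<odot>\<^bsub>M\<^esub> \<zero>\<^bsub>M\<^esub> = \<zero>\<^bsub>M\<^esub>"
  \<comment> \<open>The zero of \<open>M\<close> is rewritten as \<open>\<zero>\<close> times
    itself, and \<open>r\<close> is absorbed into that scalar.\<close>
  using assms smult_assoc1[of r "\<zero>\<^bsub>R\<^esub>" "\<zero>\<^bsub>M\<^esub>"] smult_zero[of "\<zero>\<^bsub>M\<^esub>"] by simp

text \<open>This is the kernel of \<open>r \<mapsto> r x\<close>. If \<open>x\<close> generates
  \<open>M\<close>, it serves as the \<open>I\<close> with \<open>M\<close> isomorphic to
  \<open>R/I\<close>.\<close>

lemma left_ideal_annihilator:
  assumes x: "x \<in> carrier M"
  shows "left_ideal {r \<in> carrier R. r \<odot>\<^bsub>M\<^esub> x = \<zero>\<^bsub>M\<^esub>} R"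
proof -
  have "(\<ominus>\<^bsub>R\<^esub> r) \<odot>\<^bsub>M\<^esub> x = \<zero>\<^bsub>M\<^esub>" if "r \<in> carrier R" "r \<odot>\<^bsub>M\<^esub> x = \<zero>\<^bsub>M\<^esub>" for r
    using smult_minus_eq_zero[of "\<zero>\<^bsub>R\<^esub>" r x] that x by (simp add: R.minus_eq smult_zero)
  then have "subgroup {r \<in> carrier R. r \<odot>\<^bsub>M\<^esub> x = \<zero>\<^bsub>M\<^esub>} (add_monoid R)"
    using x by unfold_locales
      (auto simp: smult_l_distr smult_zero simp flip: a_inv_def)
  then show ?thesis
    using x by (auto simp: left_ideal_def additive_subgroup_def smult_assoc1 smult_zero_right)
qed

text \<open>Right multiplication by \<open>a\<close> vanishes on the kernel of
  \<open>r \<mapsto> r x\<close>, hence factors through this map onto \<open>M\<close>.\<close>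

lemma ex_dual_extending_right_mult:
  assumes x: "x \<in> carrier M" and gen: "carrier M = {r \<odot>\<^bsub>M\<^esub> x | r. r \<in> carrier R}"
    and a: "a \<in> right_annihilator R {r \<in> carrier R. r \<odot>\<^bsub>M\<^esub> x = \<zero>\<^bsub>M\<^esub>}"
  obtains q where "q \<in> left_module_dual R M"
    and "\<And>r. r \<in> carrier R \<Longrightarrow> q (r \<odot>\<^bsub>M\<^esub> x) = r \<otimes>\<^bsub>R\<^esub> a"
proof -
  define q where "q m = (SOME r. r \<in> carrier R \<and> m = r \<odot>\<^bsub>M\<^esub> x) \<otimes>\<^bsub>R\<^esub> a" for m
  have aR: "a \<in> carrier R"
    using a by (simp add: right_annihilator_def)
  have q: "q (r \<odot>\<^bsub>M\<^esub> x) = r \<otimes>\<^bsub>R\<^esub> a" if r: "r \<in> carrier R" for r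
  proof -
    \<comment> \<open>The scalar that the choice in \<open>q\<close> assigns to \<open>r x\<close>;
      it may differ from \<open>r\<close>, but only by an element that annihilates
      \<open>x\<close>.\<close>
    define s where "s = (SOME s. s \<in> carrier R \<and> r \<odot>\<^bsub>M\<^esub> x = s \<odot>\<^bsub>M\<^esub> x)"
    have s: "s \<in> carrier R" "r \<odot>\<^bsub>M\<^esub> x = s \<odot>\<^bsub>M\<^esub> x"
      using someI[of "\<lambda>s. s \<in> carrier R \<and> r \<odot>\<^bsub>M\<^esub> x = s \<odot>\<^bsub>M\<^esub> x" r] r by (auto simp: s_def)
    then have "(r \<ominus>\<^bsub>R\<^esub> s) \<otimes>\<^bsub>R\<^esub> a = \<zero>\<^bsub>R\<^esub>"
      using a r x by (simp add: right_annihilator_def smult_minus_eq_zero)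
    then have "r \<otimes>\<^bsub>R\<^esub> a \<ominus>\<^bsub>R\<^esub> s \<otimes>\<^bsub>R\<^esub> a = \<zero>\<^bsub>R\<^esub>"
      using aR r s by (simp add: R.minus_eq R.l_distr R.l_minus)
    then have "r \<otimes>\<^bsub>R\<^esub> a = s \<otimes>\<^bsub>R\<^esub> a"
      using aR r s R.minus_equality[of "r \<otimes>\<^bsub>R\<^esub> a" "\<ominus>\<^bsub>R\<^esub> (s \<otimes>\<^bsub>R\<^esub> a)"] by (simp add: R.minus_eq)
    then show ?thesis
      by (simp only: q_def s_def)
  qed
  \<comment> \<open>Sums and multiples of multiples of \<open>x\<close> are again multiples of
    \<open>x\<close>, with scalars \<open>r + s\<close> and \<open>r s\<close>, so the formula for
    \<open>q\<close> applies to them.\<close>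
  have "q (r \<odot>\<^bsub>M\<^esub> x \<oplus>\<^bsub>M\<^esub> s \<odot>\<^bsub>M\<^esub> x) = q (r \<odot>\<^bsub>M\<^esub> x) \<oplus>\<^bsub>R\<^esub> q (s \<odot>\<^bsub>M\<^esub> x)"
    "q (r \<odot>\<^bsub>M\<^esub> (s \<odot>\<^bsub>M\<^esub> x)) = r \<otimes>\<^bsub>R\<^esub> q (s \<odot>\<^bsub>M\<^esub> x)"
    if "r \<in> carrier R" "s \<in> carrier R" for r s
    using q[of "r \<oplus>\<^bsub>R\<^esub> s"] q[of "r \<otimes>\<^bsub>R\<^esub> s"] that aR x
    by (simp_all add: q smult_l_distr smult_assoc1 R.l_distr R.m_assoc)
  moreover have "q \<in> carrier M \<rightarrow> carrier R"
    using gen q aR by auto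
  ultimately have "q \<in> left_module_dual R M"
    by (auto simp: left_module_dual_def left_module_hom_def left_regular_def gen)
  with q show thesis
    using that by blast
qed

end

text \<open>A nonzero \<open>t x\<close> has \<open>t\<close> outside the annihilator of the
  generator \<open>x\<close>, hence outside its colon. This yields \<open>a\<close> with
  \<open>t a\<close> outside the radical, and the functional sending \<open>x\<close> to
  \<open>a\<close> detects \<open>t x\<close>.\<close>

lemma J_torsionless_if_left_colon_subset:
  assumes "cyclic_left_module R M"
    and colon: "\<And>I. left_ideal I R \<Longrightarrow>
      left_colon R (jacobson_radical R) (right_annihilator R I) \<subseteq> I"
  shows "J_torsionless R M"
proof -
  interpret left_module R M
    using assms(1) by (simp add: cyclic_left_module_def)
  obtain x where x: "x \<in> carrier M" and gen: "carrier M = {r \<odot>\<^bsub>M\<^esub> x | r. r \<in> carrier R}"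
    using assms(1) by (auto simp: cyclic_left_module_def)
  let ?I = "{r \<in> carrier R. r \<odot>\<^bsub>M\<^esub> x = \<zero>\<^bsub>M\<^esub>}"
  show ?thesis
    unfolding J_torsionless_def
  proof (intro ballI impI)
    fix m assume "m \<in> carrier M" "m \<noteq> \<zero>\<^bsub>M\<^esub>"
    then obtain t where t: "t \<in> carrier R" "m = t \<odot>\<^bsub>M\<^esub> x" "t \<notin> ?I"
      using gen by auto
    then have "t \<notin> left_colon R (jacobson_radical R) (right_annihilator R ?I)"
      using colon[OF left_ideal_annihilator[OF x]] by blast
    then obtain a where a: "a \<in> right_annihilator R ?I" "t \<otimes>\<^bsub>R\<^esub> a \<notin> jacobson_radical R"
      using t unfolding left_colon_def by blast
    then show "\<exists>q\<in>left_module_dual R M. q m \<notin> jacobson_radical R"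
      using ex_dual_extending_right_mult[OF x gen a(1)] t by metis
  qed
qed

text \<open>The argument takes place in \<open>M\<close> itself, so the element type
  \<open>'m\<close> is arbitrary; the theorem uses it at \<open>'a set\<close> and at its own
  \<open>'m\<close>.\<close>

lemma all_cyclic_J_torsionless_if_left_colon_subset:
  assumes "\<And>I. left_ideal I R \<Longrightarrow>
      left_colon R (jacobson_radical R) (right_annihilator R I) \<subseteq> I"
  shows "all_cyclic_J_torsionless R TYPE('m)"
  using assms J_torsionless_if_left_colon_subset
  unfolding all_cyclic_J_torsionless_def by metis

theorem theorem3p19:
  fixes R :: "('a, 'c) ring_scheme"
  assumes "ring R"
  shows "(all_cyclic_J_torsionless R TYPE('a set) \<longleftrightarrow>
            (\<forall>I. left_ideal I R \<longrightarrow> I = left_colon R (jacobson_radical R) (right_annihilator R I)))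
       \<and> ((\<forall>I. left_ideal I R \<longrightarrow> I = left_colon R (jacobson_radical R) (right_annihilator R I))
            \<longrightarrow> all_cyclic_J_torsionless R TYPE('m))"
proof -
  \<comment> \<open>The assumption is applied to \<open>R/I\<close>, whose elements have type
    \<open>'a set\<close>.\<close>
  have "I = left_colon R (jacobson_radical R) (right_annihilator R I)"
    if "all_cyclic_J_torsionless R TYPE('a set)" "left_ideal I R" for I
    using that left_ideal_subset_left_colon[OF assms, of I]
      left_colon_subset_left_ideal[OF assms, of I] cyclic_quotient_left_module[OF assms, of I]
    by (auto simp: all_cyclic_J_torsionless_def)
  moreover note all_cyclic_J_torsionless_if_left_colon_subset[where R = R and 'm = "'a set"]
    all_cyclic_J_torsionless_if_left_colon_subset[where R = R and 'm = 'm]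
  ultimately show ?thesis
    by blast
qed

end
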